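(* For complex $\alpha,m,x,z$, $$\sum_{n=0}^{\infty}\Bigl(\frac{x}{x+1}\Bigr)^n\binom{m+n+\alpha}{n-1}\;{}_3F_2(1,1,1-n;\,2,m+\alpha+2;\,z)=\frac1z\,x^m\Bigl(\frac{x}{x+1}\Bigr)^{-m}(x+1)^{\alpha+1}\log(xz+1).$$
   Context: ${}_3F_2(a_1,a_2,a_3;b_1,b_2;z)=\sum_{k\ge0}\frac{(a_1)_k(a_2)_k(a_3)_k}{(b_1)_k(b_2)_k\,k!}z^k$ is the generalized hypergeometric function, with $(a)_k=a(a+1)\cdots(a+k-1)$. For complex $s$ and integer $r\ge0$, $\binom{s}{r}=\frac{s(s-1)\cdots(s-r+1)}{r!}$, and $\binom{s}{-1}=0$. *)

theory Defs
  imports "HOL-Analysis.Analysis" "HOL-Library.Nonpos_Ints"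
begin

text \<open>
  If an upper parameter is a nonpositive integer the series terminates and the sum is finite for
  every \<open>z\<close>. No analytic continuation is used: where the series diverges the value is unspecified.
\<close>

definition hyp3F2 ::
  "complex \<Rightarrow> complex \<Rightarrow> complex \<Rightarrow> complex \<Rightarrow> complex \<Rightarrow> complex \<Rightarrow> complex"
where
  "hyp3F2 a1 a2 a3 b1 b2 z =
     (\<Sum>k. (pochhammer a1 k * pochhammer a2 k * pochhammer a3 k) /
           (pochhammer b1 k * pochhammer b2 k * fact k) * z ^ k)"

text \<open>
  The lower index is an integer because the value at lower index \<open>-1\<close> is needed, where it is \<open>0\<close>
  by convention.
\<close>

definition cbinom :: "complex \<Rightarrow> int \<Rightarrow> complex" where
  "cbinom s r = (if r < 0 then 0 else s gchoose nat r)"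

end

theory Submission
  imports Defs
begin

text \<open>
  With \<open>w = x / (x + 1)\<close> and \<open>s = m + \<alpha>\<close> the left-hand side is a power series
  \<open>F w = (\<Sum>n. c n * w ^ n)\<close>, where \<open>c n\<close> (below: \<open>hyp_coeff s z n\<close>) is a finite sum. Pascal's rule
  and absorption give the formal differential equation
  \<open>(1 - (1 - z) w) ((1 - w) F' - (s + 1) F) = (1 - w) powr - (s + 1)\<close>,
  whose solution vanishing at 0 is \<open>(1 - w) powr - (s + 1) * (Ln (1 - (1 - z) w) - Ln (1 - w)) / z\<close>;
  this is the closed form inside the disc where both \<open>norm w < 1\<close> and \<open>norm ((1 - z) w) < 1\<close>.

  The same equation shows that the series diverges outside the closure of this disc: evaluated at
  \<open>w = 1 / (1 - z)\<close> it would make the right-hand side vanish, and if \<open>F\<close> had a radius of convergence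
  above 1 then so would the binomial series on the right, forcing \<open>s = -1\<close> and then \<open>0 = 1\<close> at
  \<open>w = 1\<close>. On the boundary, Abel's limit theorem carries the closed form over.
\<close>

section \<open>Abel's limit theorem along a radius\<close>

text \<open>Multiplying the power series by the geometric series turns its coefficients into partial
  sums. After subtracting the limit, the coefficients \<open>D k\<close> tend to 0, and the factor
  \<open>1 - r\<close> damps any finite number of them as \<open>r\<close> tends to 1.\<close>

lemma Abel_radial_limit:
  fixes a :: "nat \<Rightarrow> 'a :: {real_normed_field, banach}"
  assumes "summable a"
  shows "((\<lambda>r. \<Sum>n. a n * of_real r ^ n) \<longlongrightarrow> suminf a) (at_left (1::real))"
proof -
  define S where "S = suminf a"
  define D where "D = (\<lambda>n. (\<Sum>i\<le>n. a i) - S)"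
  have "(\<lambda>n. \<Sum>i\<le>n. a i) \<longlonglongrightarrow> S"
    unfolding S_def by (rule summable_LIMSEQ'[OF assms])
  then have D_lim: "D \<longlonglongrightarrow> 0"
    unfolding D_def by (rule LIM_zero)
  have D_sums: "(\<lambda>k. D k * of_real r ^ k) sums
      (((\<Sum>n. a n * of_real r ^ n) - S) / (1 - of_real r))"
    if r: "0 < r" "r < 1" for r :: real
  proof -
    have "summable (\<lambda>n. norm (a n * of_real r ^ n))"
      by (rule powser_insidea[of a 1]) (use assms r in auto)
    moreover have geo: "summable (\<lambda>n. norm ((of_real r :: 'a) ^ n))"
      using r by (simp add: norm_power)
    ultimately have "(\<lambda>k. \<Sum>i\<le>k. a i * of_real r ^ i * of_real r ^ (k - i)) sums
        ((\<Sum>n. a n * of_real r ^ n) * (\<Sum>n. of_real r ^ n))"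
      by (rule Cauchy_product_sums)
    moreover have "(\<lambda>k. \<Sum>i\<le>k. a i * of_real r ^ i * of_real r ^ (k - i)) =
        (\<lambda>k. (\<Sum>i\<le>k. a i) * (of_real r :: 'a) ^ k)"
      by (intro ext) (auto simp: sum_distrib_right mult.assoc simp flip: power_add intro!: sum.cong)
    moreover have "(\<lambda>n. (of_real r :: 'a) ^ n) sums (1 / (1 - of_real r))"
      by (rule geometric_sums) (use r in auto)
    ultimately have "(\<lambda>k. (\<Sum>i\<le>k. a i) * (of_real r :: 'a) ^ k - S * of_real r ^ k) sums
        ((\<Sum>n. a n * of_real r ^ n) * (1 / (1 - of_real r)) - S * (1 / (1 - of_real r)))"
      by (intro sums_diff sums_mult) (simp_all add: sums_iff)
    then show ?thesis
      by (simp add: D_def algebra_simps diff_divide_distrib)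
  qed
  have "((\<lambda>r. (\<Sum>n. a n * of_real r ^ n)) \<longlongrightarrow> S) (at_left (1::real))"
  proof (rule tendstoI)
    fix e :: real assume "e > 0"
    then obtain N where N: "\<And>n. n \<ge> N \<Longrightarrow> norm (D n) < e / 2"
      using D_lim by (metis LIMSEQ_iff diff_zero half_gt_zero)
    define M where "M = (\<Sum>k<N. norm (D k))"
    have bound: "norm ((\<Sum>n. a n * of_real r ^ n) - S) \<le> M * (1 - r) + e / 2"
      if r: "0 < r" "r < 1" for r :: real
    proof -
      \<comment> \<open>The first \<open>N\<close> terms are bounded without their powers of
        \<open>r\<close>, so that \<open>M\<close> does not depend on \<open>r\<close>; the tail is
        dominated by a geometric series, whose sum cancels against \<open>1 - r\<close>.\<close>
      let ?g = "\<lambda>k. (if k < N then norm (D k) else 0) + e / 2 * r ^ k"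
      have "(\<lambda>k. if k \<in> {..<N} then norm (D k) else 0) sums M"
        unfolding M_def by (rule sums_If_finite_set) simp
      moreover have "(\<lambda>k. r ^ k) sums (1 / (1 - r))"
        by (rule geometric_sums) (use r in auto)
      ultimately have g: "?g sums (M + e / 2 * (1 / (1 - r)))"
        by (intro sums_add sums_mult) simp_all
      have le: "norm (D k * of_real r ^ k) \<le> ?g k" for k
      proof (cases "k < N")
        case True
        have "norm (D k) * r ^ k \<le> norm (D k) * 1"
          using r by (intro mult_left_mono power_le_one) auto
        moreover have "0 \<le> e * r ^ k"
          using r \<open>e > 0\<close> by simp
        ultimately show ?thesis
          using True r by (simp add: norm_mult norm_power)
      next
        case False
        then show ?thesis
          using N[of k] r by (simp add: norm_mult norm_power mult_right_mono)
      qed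
      have "norm (((\<Sum>n. a n * of_real r ^ n) - S) / (1 - of_real r)) \<le> M + e / 2 * (1 / (1 - r))"
        using norm_suminf_le[OF le sums_summable[OF g]]
        by (simp only: sums_unique[OF D_sums[OF r], symmetric] sums_unique[OF g, symmetric])
      moreover have "norm (1 - of_real r :: 'a) = 1 - r"
        using r by (metis abs_of_pos diff_gt_0_iff_gt norm_of_real of_real_1 of_real_diff)
      ultimately have "norm ((\<Sum>n. a n * of_real r ^ n) - S) / (1 - r) \<le> (M * (1 - r) + e / 2) / (1 - r)"
        using r by (simp add: norm_divide add_divide_distrib)
      then show ?thesis
        using r by (simp add: divide_le_cancel)
    qed
    have "((\<lambda>r::real. M * (1 - r) + e / 2) \<longlongrightarrow> M * (1 - 1) + e / 2) (at_left 1)"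
      by (intro tendsto_intros)
    then have "eventually (\<lambda>r. M * (1 - r) + e / 2 < e) (at_left (1::real))"
      by (rule order_tendstoD(2)) (use \<open>e > 0\<close> in simp)
    moreover have "eventually (\<lambda>r. r \<in> {0<..<1}) (at_left (1::real))"
      by (rule eventually_at_left_real) simp
    ultimately show "eventually (\<lambda>r. dist (\<Sum>n. a n * of_real r ^ n) S < e) (at_left (1::real))"
      by eventually_elim (use bound in \<open>force simp: dist_norm\<close>)
  qed
  then show ?thesis by (simp add: S_def)
qed

section \<open>The coefficients as finite sums\<close>

text \<open>This is what remains of binomial times hypergeometric sum once the Pochhammer symbols
  cancel; it is polynomial in \<open>s\<close> and \<open>z\<close>. The empty sum at
  \<open>n = 0\<close> matches the convention for lower index -1.\<close>

definition hyp_coeff :: "complex \<Rightarrow> complex \<Rightarrow> nat \<Rightarrow> complex" where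
  "hyp_coeff s z n = (\<Sum>j<n. (- z) ^ j / of_nat (Suc j) * (s + of_nat n gchoose (n - Suc j)))"

lemma pochhammer_neg_of_nat:
  assumes "k \<le> N"
  shows "pochhammer (- of_nat N :: 'a::field_char_0) k = (- 1) ^ k * fact N / fact (N - k)"
proof -
  have "(of_nat N gchoose k :: 'a) = fact N / (fact k * fact (N - k))"
    using assms by (simp flip: binomial_gbinomial add: binomial_fact)
  then have "(- 1) ^ k * pochhammer (- of_nat N :: 'a) k = fact N / fact (N - k)"
    by (simp add: gbinomial_pochhammer field_simps)
  then have "(- 1) ^ k * ((- 1) ^ k * pochhammer (- of_nat N :: 'a) k) = (- 1) ^ k * (fact N / fact (N - k))"
    by simp
  then show ?thesis
    by (simp flip: mult.assoc power_mult_distrib)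
qed

text \<open>With \<open>n = Suc N\<close>, the parameter \<open>- of_nat N\<close> cuts the series
  off after \<open>k = N\<close>. The binomial equals \<open>pochhammer (s + 2) N / fact N\<close>,
  and splitting this symbol at \<open>k\<close> cancels the denominator
  \<open>pochhammer (s + 2) k\<close>, nonzero by the assumption on \<open>s\<close>.\<close>

lemma cbinom_hyp3F2_eq:
  assumes "s + 2 \<notin> \<int>\<^sub>\<le>\<^sub>0"
  shows "cbinom (s + of_nat n) (int n - 1) * hyp3F2 1 1 (1 - of_nat n) 2 (s + 2) z
         = hyp_coeff s z n"
proof (cases n)
  case 0
  then show ?thesis by (simp add: cbinom_def hyp_coeff_def)
next
  case (Suc N)
  have poch2: "pochhammer 2 k = (fact (Suc k) :: complex)" for k
    by (simp only: pochhammer_fact pochhammer_rec) simp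
  have nz: "pochhammer (s + 2) k \<noteq> 0" for k
    using assms by (auto simp: pochhammer_eq_0_iff)
  have term_eq: "(s + of_nat n gchoose N) *
      (pochhammer 1 k * pochhammer 1 k * pochhammer (- of_nat N) k /
           (pochhammer 2 k * pochhammer (s + 2) k * fact k) * z ^ k)
      = (- z) ^ k / of_nat (Suc k) * (s + of_nat n gchoose (N - k))" if "k \<le> N" for k
  proof -
    have 1: "s + of_nat n gchoose N = pochhammer (s + 2) N / fact N"
      using Suc by (simp add: gbinomial_pochhammer' algebra_simps)
    have 2: "s + of_nat n gchoose (N - k) = pochhammer (s + 2 + of_nat k) (N - k) / fact (N - k)"
      using Suc that by (simp add: gbinomial_pochhammer' of_nat_diff algebra_simps)
    have 3: "pochhammer (s + 2) N = pochhammer (s + 2) k * pochhammer (s + 2 + of_nat k) (N - k)"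
      using that by (rule pochhammer_product)
    have 4: "pochhammer 1 k = (fact k :: complex)"
      by (simp add: pochhammer_fact)
    have 5: "(- z) ^ k = (-1) ^ k * z ^ k"
      by (rule power_minus)
    show ?thesis
      unfolding 1 2 3 4 5 poch2 pochhammer_neg_of_nat[OF that] fact_Suc
      using nz[of k] by (simp add: divide_simps del: of_nat_Suc)
  qed
  have "hyp3F2 1 1 (- of_nat N) 2 (s + 2) z =
      (\<Sum>k\<le>N. pochhammer 1 k * pochhammer 1 k * pochhammer (- of_nat N) k /
           (pochhammer 2 k * pochhammer (s + 2) k * fact k) * z ^ k)"
    unfolding hyp3F2_def
    by (rule suminf_finite) (auto simp: pochhammer_of_nat_eq_0_lemma)
  then have "cbinom (s + of_nat n) (int n - 1) * hyp3F2 1 1 (1 - of_nat n) 2 (s + 2) z =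
      (\<Sum>k\<le>N. (s + of_nat n gchoose N) *
        (pochhammer 1 k * pochhammer 1 k * pochhammer (- of_nat N) k /
           (pochhammer 2 k * pochhammer (s + 2) k * fact k) * z ^ k))"
    using Suc by (simp add: cbinom_def sum_distrib_left)
  also have "\<dots> = (\<Sum>k\<le>N. (- z) ^ k / of_nat (Suc k) * (s + of_nat n gchoose (N - k)))"
    by (intro sum.cong refl term_eq) simp
  also have "\<dots> = hyp_coeff s z n"
    unfolding hyp_coeff_def Suc by (simp add: lessThan_Suc_atMost)
  finally show ?thesis .
qed

section \<open>The formal differential equation and its solution\<close>

definition hyp_fps :: "complex \<Rightarrow> complex \<Rightarrow> complex fps" where
  "hyp_fps s z = Abs_fps (hyp_coeff s z)"

text \<open>The expansion of \<open>(1 - w) powr - (s + 1)\<close>.\<close>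
definition binom_fps :: "complex \<Rightarrow> complex fps" where
  "binom_fps s = Abs_fps (\<lambda>n. s + of_nat n gchoose n)"

text \<open>The expansion of \<open>(Ln (1 - (1 - z) * w) - Ln (1 - w)) / z\<close> in
  \<open>w\<close>. At \<open>n = 0\<close> the quotient is 0, as the constant term should
  be.\<close>

definition log_fps :: "complex \<Rightarrow> complex fps" where
  "log_fps z = Abs_fps (\<lambda>n. (1 - (1 - z) ^ n) / (of_nat n * z))"

lemma binom_fps_ode:
  "(1 - fps_X) * fps_deriv (binom_fps s) = fps_const (s + 1) * binom_fps s"
proof (rule fps_ext)
  fix n :: nat
  have "of_nat (Suc n) * (s + of_nat (Suc n) gchoose Suc n) = (s + of_nat n + 1) * (s + of_nat n gchoose n)"
    using Suc_times_gbinomial[of n "s + of_nat n"] by (simp add: algebra_simps)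
  then show "fps_nth ((1 - fps_X) * fps_deriv (binom_fps s)) n
      = fps_nth (fps_const (s + 1) * binom_fps s) n"
    by (cases n) (simp_all add: binom_fps_def left_diff_distrib del: of_nat_Suc,
       simp_all add: algebra_simps)
qed

lemma log_fps_ode:
  assumes "z \<noteq> 0"
  shows "(1 - fps_X) * ((1 - fps_const (1 - z) * fps_X) * fps_deriv (log_fps z)) = 1"
proof -
  have nth: "fps_nth (fps_deriv (log_fps z)) n = (1 - (1 - z) ^ Suc n) / z" for n
    by (simp add: log_fps_def del: of_nat_Suc power_Suc)
  have "(1 - fps_const (1 - z) * fps_X) * fps_deriv (log_fps z) = Abs_fps (\<lambda>_. 1)"
  proof (rule fps_ext)
    fix n
    show "fps_nth ((1 - fps_const (1 - z) * fps_X) * fps_deriv (log_fps z)) n = fps_nth (Abs_fps (\<lambda>_. 1)) n"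
      by (cases n) (use assms in \<open>simp_all add: left_diff_distrib mult.assoc nth del: fps_deriv_nth\<close>,
        simp add: field_simps)
  qed
  moreover have "(1 - fps_X) * Abs_fps (\<lambda>_. 1 :: complex) = 1"
    by (rule fps_ext) (simp add: left_diff_distrib)
  ultimately show ?thesis by simp
qed

text \<open>Absorption removes the denominators \<open>Suc j\<close>, which shows the inner bracket
  to have coefficients \<open>p n\<close>. Pascal's rule then gives a first-order recurrence for
  \<open>p\<close>, and this is multiplication by the outer factor.\<close>

lemma hyp_fps_ode:
  "(1 - fps_const (1 - z) * fps_X) *
     ((1 - fps_X) * fps_deriv (hyp_fps s z) - fps_const (s + 1) * hyp_fps s z) = binom_fps s"
proof -
  define p where "p = (\<lambda>n. \<Sum>j\<le>n. (- z) ^ j * (s + 1 + of_nat n gchoose (n - j)))"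
  have rec: "of_nat (Suc n) * hyp_coeff s z (Suc n) - (s + 1 + of_nat n) * hyp_coeff s z n = p n" for n
  proof -
    have "(s + 1 + of_nat n) * hyp_coeff s z n
      = (\<Sum>j<n. (- z) ^ j / of_nat (Suc j) * (of_nat (n - j) * (s + 1 + of_nat n gchoose (n - j))))"
      unfolding hyp_coeff_def sum_distrib_left
    proof (intro sum.cong refl)
      fix j assume "j \<in> {..<n}"
      then have "of_nat (n - j) * (s + 1 + of_nat n gchoose (n - j))
          = (s + 1 + of_nat n) * (s + of_nat n gchoose (n - Suc j))"
        using Suc_times_gbinomial[of "n - Suc j" "s + of_nat n"]
        by (simp add: Suc_diff_Suc add_ac del: of_nat_Suc)
      then show "(s + 1 + of_nat n) * ((- z) ^ j / of_nat (Suc j) * (s + of_nat n gchoose (n - Suc j)))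
        = (- z) ^ j / of_nat (Suc j) * (of_nat (n - j) * (s + 1 + of_nat n gchoose (n - j)))"
        by simp
    qed
    \<comment> \<open>The added term \<open>j = n\<close> contains the factor
      \<open>of_nat (n - j) = 0\<close>.\<close>
    also have "\<dots> = (\<Sum>j\<le>n. (- z) ^ j / of_nat (Suc j) * (of_nat (n - j) * (s + 1 + of_nat n gchoose (n - j))))"
      by (simp flip: lessThan_Suc_atMost)
    finally have 1: "(s + 1 + of_nat n) * hyp_coeff s z n = \<dots>" .
    have 2: "of_nat (Suc n) * hyp_coeff s z (Suc n)
      = (\<Sum>j\<le>n. (- z) ^ j / of_nat (Suc j) * (of_nat (Suc n) * (s + 1 + of_nat n gchoose (n - j))))"
      unfolding hyp_coeff_def sum_distrib_left
      by (intro sum.cong) (auto simp: lessThan_Suc_atMost add_ac)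
    show ?thesis
      unfolding 1 2 p_def sum_subtractf[symmetric]
    proof (intro sum.cong refl)
      fix j assume "j \<in> {..n}"
      then have "of_nat (Suc n) - of_nat (n - j) = (of_nat (Suc j) :: complex)"
        by (simp add: of_nat_diff)
      then have "(- z) ^ j / of_nat (Suc j) * ((of_nat (Suc n) - of_nat (n - j)) * C) = (- z) ^ j * C" for C
        by (simp del: of_nat_Suc)
      then show "(- z) ^ j / of_nat (Suc j) * (of_nat (Suc n) * (s + 1 + of_nat n gchoose (n - j)))
         - (- z) ^ j / of_nat (Suc j) * (of_nat (n - j) * (s + 1 + of_nat n gchoose (n - j)))
         = (- z) ^ j * (s + 1 + of_nat n gchoose (n - j))"
        by (simp only: right_diff_distrib left_diff_distrib)
    qed
  qed
  have ode: "(1 - fps_X) * fps_deriv (hyp_fps s z) - fps_const (s + 1) * hyp_fps s z = Abs_fps p"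
  proof (rule fps_ext)
    fix n
    show "fps_nth ((1 - fps_X) * fps_deriv (hyp_fps s z) - fps_const (s + 1) * hyp_fps s z) n
      = fps_nth (Abs_fps p) n"
      using rec[of n]
      by (cases n) (simp_all add: hyp_fps_def left_diff_distrib del: of_nat_Suc,
       simp_all add: algebra_simps)
  qed
  have pascal: "p (Suc n) - (1 - z) * p n = s + of_nat (Suc n) gchoose (Suc n)" for n
  proof -
    define C where "C = (\<lambda>k. s + 1 + of_nat n gchoose k)"
    have C: "s + 1 + of_nat (Suc n) gchoose (Suc k) = C k + C (Suc k)" for k
      using gbinomial_Suc_Suc[of "s + 1 + of_nat n" k] by (simp add: C_def add_ac)
    have pn: "p n = (\<Sum>j\<le>n. (- z) ^ j * C (n - j))"
      by (simp add: p_def C_def)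
    have "p (Suc n) = (\<Sum>j\<le>n. (- z) ^ j * (s + 1 + of_nat (Suc n) gchoose Suc (n - j))) + (- z) ^ Suc n"
      unfolding p_def by (simp add: Suc_diff_le del: of_nat_Suc)
    also have "\<dots> = p n + ((\<Sum>j\<le>n. (- z) ^ j * C (Suc n - j)) + (- z) ^ Suc n * C 0)"
      unfolding C pn by (simp add: ring_distribs sum.distrib Suc_diff_le C_def del: of_nat_Suc)
    also have "(\<Sum>j\<le>n. (- z) ^ j * C (Suc n - j)) + (- z) ^ Suc n * C 0
        = (\<Sum>j\<le>Suc n. (- z) ^ j * C (Suc n - j))"
      by simp
    \<comment> \<open>Splitting off \<open>j = 0\<close> and shifting the index takes one factor
      \<open>- z\<close> out of the remaining sum, which is again \<open>p n\<close>.\<close>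
    also have "\<dots> = C (Suc n) - z * p n"
      unfolding sum.atMost_Suc_shift pn by (simp add: sum_distrib_left sum_negf mult.assoc)
    finally show ?thesis
      by (simp add: algebra_simps C_def)
  qed
  have "(1 - fps_const (1 - z) * fps_X) * Abs_fps p = binom_fps s"
  proof (rule fps_ext)
    fix n
    show "fps_nth ((1 - fps_const (1 - z) * fps_X) * Abs_fps p) n = fps_nth (binom_fps s) n"
    proof (cases n)
      case 0
      then show ?thesis by (simp add: binom_fps_def p_def left_diff_distrib mult.assoc)
    next
      case (Suc k)
      then show ?thesis
        using pascal[of k] by (simp add: binom_fps_def left_diff_distrib mult.assoc del: of_nat_Suc)
    qed
  qed
  then show ?thesis by (simp add: ode)
qed

text \<open>Both sides solve the same linear equation, so their difference \<open>H\<close> solves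
  the homogeneous one. Its constant term is 0, and comparing coefficients determines each further
  coefficient from the preceding one.\<close>

lemma hyp_fps_eq:
  assumes "z \<noteq> 0"
  shows "hyp_fps s z = binom_fps s * log_fps z"
proof -
  define u where "u = 1 - fps_const (1 - z) * fps_X"
  define H where "H = hyp_fps s z - binom_fps s * log_fps z"
  have "u \<noteq> 0"
  proof
    assume "u = 0"
    then have "fps_nth u 0 = 0" by simp
    then show False by (simp add: u_def)
  qed
  have "(1 - fps_X) * fps_deriv (binom_fps s * log_fps z)
      = fps_const (s + 1) * binom_fps s * log_fps z + binom_fps s * ((1 - fps_X) * fps_deriv (log_fps z))"
    by (simp add: binom_fps_ode[symmetric]) (simp add: algebra_simps)
  then have "u * ((1 - fps_X) * fps_deriv H - fps_const (s + 1) * H)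
      = u * ((1 - fps_X) * fps_deriv (hyp_fps s z) - fps_const (s + 1) * hyp_fps s z)
        - binom_fps s * ((1 - fps_X) * (u * fps_deriv (log_fps z)))"
    unfolding H_def by (simp add: algebra_simps)
  also have "\<dots> = 0"
    using hyp_fps_ode[of z s] log_fps_ode[OF assms] by (simp add: u_def)
  \<comment> \<open>Formal power series over a field have no zero divisors, so \<open>u\<close>
    cancels.\<close>
  finally have ode: "(1 - fps_X) * fps_deriv H = fps_const (s + 1) * H"
    using \<open>u \<noteq> 0\<close> by simp
  have "fps_nth H n = 0" for n
  proof (induction n)
    case 0
    then show ?case by (simp add: H_def hyp_fps_def log_fps_def hyp_coeff_def)
  next
    case (Suc n)
    have "fps_nth ((1 - fps_X) * fps_deriv H) n = 0"
      unfolding ode by (simp add: Suc)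
    then show ?case
      using Suc by (cases n) (simp_all add: left_diff_distrib del: of_nat_Suc)
  qed
  then show ?thesis
    by (simp add: H_def fps_eq_iff)
qed


section \<open>Convergence and closed form inside the disc\<close>

lemma binom_fps_nth:
  "fps_nth (binom_fps s) n = (- 1) ^ n * (- (s + 1) gchoose n)"
  unfolding gbinomial_minus by (simp add: binom_fps_def mult.assoc[symmetric] flip: power_mult_distrib)

lemma fps_conv_radius_binom_fps:
  "fps_conv_radius (binom_fps s) = (if - (s + 1) \<in> \<nat> then \<infinity> else 1)"
proof -
  have "fps_conv_radius (binom_fps s) = conv_radius (\<lambda>n. - (s + 1) gchoose n)"
    unfolding fps_conv_radius_def conv_radius_def binom_fps_nth
    by (simp add: norm_mult norm_power)
  then show ?thesis by (simp only: conv_radius_gchoose)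
qed

lemma eval_binom_fps:
  assumes "norm w < 1"
  shows "eval_fps (binom_fps s) w = (1 - w) powr (- (s + 1))"
proof -
  have "(\<lambda>n. (- (s + 1) gchoose n) * (- w) ^ n) sums (1 + - w) powr (- (s + 1))"
    by (rule gen_binomial_complex) (use assms in simp)
  moreover have "(\<lambda>n. (- (s + 1) gchoose n) * (- w) ^ n) = (\<lambda>n. fps_nth (binom_fps s) n * w ^ n)"
    by (simp add: binom_fps_nth power_minus[of w] mult_ac)
  ultimately show ?thesis by (simp add: eval_fps_def sums_iff)
qed

text \<open>The two logarithmic series are subtracted termwise. Absolute convergence, by comparison
  with two geometric series, is what the later Cauchy product requires.\<close>

lemma log_fps_sums:
  assumes "norm w < 1" "norm ((1 - z) * w) < 1"
  shows "(\<lambda>n. fps_nth (log_fps z) n * w ^ n) sums ((Ln (1 - (1 - z) * w) - Ln (1 - w)) / z)"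
    and "summable (\<lambda>n. norm (fps_nth (log_fps z) n * w ^ n))"
proof -
  have eq: "fps_nth (log_fps z) n * w ^ n
      = (- (((1 - z) * w) ^ n) / of_nat n - - (w ^ n) / of_nat n) / z" for n
    by (simp add: log_fps_def power_mult_distrib divide_simps) (simp add: algebra_simps)
  show "(\<lambda>n. fps_nth (log_fps z) n * w ^ n) sums ((Ln (1 - (1 - z) * w) - Ln (1 - w)) / z)"
    unfolding eq
    using Ln_series'[of "- w"] Ln_series'[of "- ((1 - z) * w)"] assms
    by (intro sums_divide sums_diff) simp_all
  show "summable (\<lambda>n. norm (fps_nth (log_fps z) n * w ^ n))"
  proof (rule summable_comparison_test)
    show "summable (\<lambda>n. (norm ((1 - z) * w) ^ n + norm w ^ n) / norm z)"
      using assms by (intro summable_divide summable_add summable_geometric) simp_all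
    have le: "norm (c / of_nat n :: complex) \<le> norm c" for c and n :: nat
    proof (cases n)
      case (Suc k)
      have "norm c * 1 \<le> norm c * real n"
        using Suc by (intro mult_left_mono) auto
      then show ?thesis using Suc by (simp add: norm_divide field_simps del: of_nat_Suc)
    qed simp
    have "norm (fps_nth (log_fps z) n * w ^ n) \<le> (norm ((1 - z) * w) ^ n + norm w ^ n) / norm z" for n
    proof -
      have "norm (- (((1 - z) * w) ^ n) / of_nat n - - (w ^ n) / of_nat n)
        \<le> norm (- (((1 - z) * w) ^ n)) + norm (- (w ^ n))"
        by (rule order_trans[OF norm_triangle_ineq4 add_mono[OF le le]])
      then show ?thesis
        unfolding eq norm_divide[of _ z]
        by (intro divide_right_mono) (simp_all add: norm_power)
    qed
    then show "\<exists>N. \<forall>n\<ge>N. norm (norm (fps_nth (log_fps z) n * w ^ n))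
        \<le> (norm ((1 - z) * w) ^ n + norm w ^ n) / norm z"
      by simp
  qed
qed

text \<open>The formal factorisation identifies \<open>hyp_coeff\<close> with the Cauchy product of
  two absolutely convergent series, so no growth estimate for the coefficients themselves is
  needed.\<close>

lemma hyp_coeff_sums:
  assumes "z \<noteq> 0" "norm w < 1" "norm ((1 - z) * w) < 1"
  shows "(\<lambda>n. hyp_coeff s z n * w ^ n) sums
    ((1 - w) powr (- (s + 1)) * ((Ln (1 - (1 - z) * w) - Ln (1 - w)) / z))"
proof -
  have "ereal (norm w) < fps_conv_radius (binom_fps s)"
    using assms(2) by (simp add: fps_conv_radius_binom_fps one_ereal_def)
  then have "summable (\<lambda>n. norm (fps_nth (binom_fps s) n * w ^ n))"
    by (rule norm_summable_fps)
  from Cauchy_product_sums[OF this log_fps_sums(2)[OF assms(2,3)]]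
  have "(\<lambda>n. \<Sum>i\<le>n. fps_nth (binom_fps s) i * w ^ i * (fps_nth (log_fps z) (n - i) * w ^ (n - i))) sums
      (eval_fps (binom_fps s) w * (\<Sum>n. fps_nth (log_fps z) n * w ^ n))"
    by (simp add: eval_fps_def)
  moreover have "(\<Sum>i\<le>n. fps_nth (binom_fps s) i * w ^ i * (fps_nth (log_fps z) (n - i) * w ^ (n - i)))
      = hyp_coeff s z n * w ^ n" for n
  proof -
    have "hyp_coeff s z n = fps_nth (binom_fps s * log_fps z) n"
      using hyp_fps_eq[OF assms(1), of s] by (simp add: hyp_fps_def fps_eq_iff)
    then have "hyp_coeff s z n * w ^ n = (\<Sum>i\<le>n. fps_nth (binom_fps s) i * fps_nth (log_fps z) (n - i) * w ^ n)"
      by (simp add: fps_mult_nth atLeast0AtMost sum_distrib_right)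
    also have "\<dots> = (\<Sum>i\<le>n. fps_nth (binom_fps s) i * fps_nth (log_fps z) (n - i) * (w ^ i * w ^ (n - i)))"
      by (intro sum.cong refl) (simp flip: power_add)
    finally show ?thesis by (simp add: mult_ac)
  qed
  ultimately show ?thesis
    using log_fps_sums(1)[OF assms(2,3)] by (simp add: eval_binom_fps[OF assms(2)] sums_iff)
qed

section \<open>Divergence outside the closed disc\<close>

lemma summable_hyp_coeff_imp_norm_le:
  assumes "z \<noteq> 0" "s + 2 \<notin> \<int>\<^sub>\<le>\<^sub>0" "summable (\<lambda>n. hyp_coeff s z n * w ^ n)"
  shows "norm w \<le> 1 \<and> norm ((1 - z) * w) \<le> 1"
proof -
  define F where "F = hyp_fps s z"
  define K where "K = (1 - fps_X) * fps_deriv F - fps_const (s + 1) * F"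
  define U where "U = 1 - fps_const (1 - z) * fps_X"
  have UK: "U * K = binom_fps s"
    unfolding U_def K_def F_def by (rule hyp_fps_ode)
  have F: "ereal (norm w) \<le> fps_conv_radius F"
    unfolding fps_conv_radius_def F_def hyp_fps_def
    using conv_radius_geI[OF assms(3)] by simp
  have F': "ereal (norm w) \<le> fps_conv_radius (fps_deriv F)"
    using F fps_conv_radius_deriv order_trans by blast
  have mult: "R \<le> fps_conv_radius (f * g)" if "R \<le> fps_conv_radius f" "R \<le> fps_conv_radius g"
    for R and f g :: "complex fps"
    using that fps_conv_radius_mult[of f g] by (meson min.boundedI order_trans)
  have diff: "R \<le> fps_conv_radius (f - g)" if "R \<le> fps_conv_radius f" "R \<le> fps_conv_radius g"
    for R and f g :: "complex fps"
    using that fps_conv_radius_diff[of f g] by (meson min.boundedI order_trans)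
  have radii: "ereal (norm w) \<le> fps_conv_radius ((1 - fps_X) * fps_deriv F)"
    "ereal (norm w) \<le> fps_conv_radius (fps_const (s + 1) * F)"
    "ereal (norm w) \<le> fps_conv_radius K" "ereal (norm w) \<le> fps_conv_radius U"
    unfolding K_def U_def using F F' by (intro mult diff; simp)+
  have eval_U: "eval_fps U y = 1 - (1 - z) * y" for y
  proof -
    have "\<infinity> \<le> fps_conv_radius (fps_const (1 - z) * fps_X)"
      by (intro mult) simp_all
    then show ?thesis
      unfolding U_def by (simp add: eval_fps_diff eval_fps_mult)
  qed
  \<comment> \<open>Summability at \<open>w\<close> bounds the radius of \<open>F\<close> from below
    by \<open>norm w\<close>, hence also that of \<open>K\<close>; the formal identity may therefore
    be evaluated strictly inside that radius.\<close>
  have eval_UK: "eval_fps (binom_fps s) y = (1 - (1 - z) * y) * eval_fps K y" if "norm y < norm w" for y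
  proof -
    have "ereal (norm y) < ereal (norm w)" using that by simp
    then have "eval_fps (U * K) y = eval_fps U y * eval_fps K y"
      using radii(3,4) less_le_trans by (intro eval_fps_mult) blast+
    then show ?thesis by (simp add: UK eval_U)
  qed
  have w1: "norm w \<le> 1"
  proof (rule ccontr)
    assume "\<not> norm w \<le> 1"
    then have w: "1 < norm w" by simp
    have "ereal (norm w) \<le> fps_conv_radius (binom_fps s)"
      unfolding UK[symmetric] using radii by (intro mult)
    then have "- (s + 1) \<in> \<nat>"
      using w by (auto simp: fps_conv_radius_binom_fps one_ereal_def split: if_splits)
    then obtain k where k: "- (s + 1) = of_nat k" by (auto elim: Nats_cases)
    \<comment> \<open>For positive \<open>k\<close>, \<open>s + 2\<close> would be the nonpositive
      integer \<open>- of_nat (k - 1)\<close>, which is excluded.\<close>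
    have "k = 0"
    proof (rule ccontr)
      assume "k \<noteq> 0"
      then have "s + 2 = - of_nat (k - 1)"
        by (simp add: of_nat_diff flip: k)
      then show False using assms(2) by simp
    qed
    with k have s: "s = - 1" by (metis add_eq_0_iff2 neg_equal_0_iff_equal of_nat_0)
    have "binom_fps s = 1"
      by (rule fps_ext) (simp add: binom_fps_nth s gbinomial_0_left)
    moreover have "eval_fps K 1 = 0"
    proof -
      have "K = (1 - fps_X) * fps_deriv F" by (simp add: K_def s)
      moreover have "ereal (norm (1::complex)) < fps_conv_radius (fps_deriv F)"
        using w F' by (intro less_le_trans[OF _ F']) simp
      ultimately show ?thesis
        by (simp add: eval_fps_mult eval_fps_diff less_le_trans[OF _ diff])
    qed
    ultimately show False using eval_UK[of 1] w by simp
  qed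
  moreover have "norm ((1 - z) * w) \<le> 1"
  proof (rule ccontr)
    assume *: "\<not> norm ((1 - z) * w) \<le> 1"
    \<comment> \<open>The zero of \<open>U\<close>. It lies strictly inside the disc of radius
      \<open>norm w\<close>, where the binomial series equals a power that vanishes only for base
      0.\<close>
    define y where "y = 1 / (1 - z)"
    have z: "1 - z \<noteq> 0" using * by auto
    have "1 < norm (1 - z) * norm w" using * by (simp only: norm_mult not_le)
    then have y: "norm y < norm w"
      using z by (simp add: y_def norm_divide pos_divide_less_eq mult.commute)
    have "(1 - (1 - z) * y) = 0" using z by (simp add: y_def)
    then have "(1 - y) powr (- (s + 1)) = 0"
      using eval_UK[OF y] eval_binom_fps[of y s] y w1 by simp
    then have "y = 1" by simp
    then show False using y w1 by simp
  qed
  ultimately show ?thesis by blast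
qed

section \<open>Boundary points\<close>

text \<open>The closed unit disc meets the line of real part 1 only at 1. This keeps the arguments
  of the logarithms off the branch cut, even on the boundary.\<close>

lemma Re_one_minus_pos:
  fixes w :: complex
  assumes "norm w \<le> 1" "w \<noteq> 1"
  shows "Re (1 - w) > 0"
proof (rule ccontr)
  assume "\<not> Re (1 - w) > 0"
  then have "Re w = norm w" "norm w = 1"
    using assms(1) complex_Re_le_cmod[of w] by auto
  then show False
    using assms(2) by (simp add: complex_eq_iff cmod_def)
qed

text \<open>Summability puts \<open>w\<close> in the closed disc, so \<open>w * of_real r\<close>
  with \<open>0 < r < 1\<close> lies in the open one, where the closed form \<open>G\<close> is
  known. As \<open>r\<close> tends to 1, Abel's theorem gives the limit of the series and continuity
  that of \<open>G\<close>.\<close>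

lemma suminf_hyp_coeff:
  assumes "z \<noteq> 0" "s + 2 \<notin> \<int>\<^sub>\<le>\<^sub>0" "summable (\<lambda>n. hyp_coeff s z n * w ^ n)"
    and "w \<noteq> 1" "(1 - z) * w \<noteq> 1"
  shows "(\<Sum>n. hyp_coeff s z n * w ^ n) =
    (1 - w) powr (- (s + 1)) * ((Ln (1 - (1 - z) * w) - Ln (1 - w)) / z)"
proof -
  have norms: "norm w \<le> 1" "norm ((1 - z) * w) \<le> 1"
    using summable_hyp_coeff_imp_norm_le[OF assms(1-3)] by auto
  have nonpos: "1 - w \<notin> \<real>\<^sub>\<le>\<^sub>0" "1 - (1 - z) * w \<notin> \<real>\<^sub>\<le>\<^sub>0"
    using Re_one_minus_pos[OF norms(1) assms(4)] Re_one_minus_pos[OF norms(2) assms(5)]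
    by (auto simp: complex_nonpos_Reals_iff)
  define G where "G = (\<lambda>y. (1 - y) powr (- (s + 1)) * ((Ln (1 - (1 - z) * y) - Ln (1 - y)) / z))"
  have "((\<lambda>r. \<Sum>n. hyp_coeff s z n * w ^ n * of_real r ^ n) \<longlongrightarrow> (\<Sum>n. hyp_coeff s z n * w ^ n))
      (at_left (1::real))"
    by (rule Abel_radial_limit[OF assms(3)])
  moreover have "eventually (\<lambda>r. r \<in> {0<..<1}) (at_left (1::real))"
    by (rule eventually_at_left_real) simp
  then have "eventually (\<lambda>r. (\<Sum>n. hyp_coeff s z n * w ^ n * of_real r ^ n) = G (w * of_real r))
      (at_left (1::real))"
  proof eventually_elim
    case (elim r)
    have small: "norm (y * of_real r) < 1" if "norm y \<le> 1" for y :: complex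
    proof -
      have "norm (y * of_real r) = norm y * r" using elim by (simp add: norm_mult)
      also have "\<dots> \<le> 1 * r" using that elim by (intro mult_right_mono) auto
      also have "\<dots> < 1" using elim by simp
      finally show ?thesis .
    qed
    have "(\<lambda>n. hyp_coeff s z n * (w * of_real r) ^ n) sums G (w * of_real r)"
      unfolding G_def
      using small[OF norms(1)] small[OF norms(2)] by (intro hyp_coeff_sums assms(1)) (simp_all add: mult.assoc)
    then show ?case by (simp add: sums_iff power_mult_distrib mult.assoc)
  qed
  ultimately have "((\<lambda>r. G (w * of_real r)) \<longlongrightarrow> (\<Sum>n. hyp_coeff s z n * w ^ n)) (at_left (1::real))"
    by (rule Lim_transform_eventually)
  moreover have "((\<lambda>r. G (w * of_real r)) \<longlongrightarrow> G (w * of_real 1)) (at_left (1::real))"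
    unfolding G_def using nonpos assms(1,4)
    by (intro tendsto_intros) (simp_all add: complex_nonpos_Reals_iff)
  ultimately have "(\<Sum>n. hyp_coeff s z n * w ^ n) = G (w * of_real 1)"
    by (intro tendsto_unique[of "at_left (1::real)"]) auto
  then show ?thesis by (simp add: G_def)
qed

section \<open>Principal branches and the identity in terms of \<open>x\<close>\<close>

text \<open>The imaginary parts of \<open>x\<close>, \<open>x + 1\<close> and \<open>x / (x + 1)\<close> have the same sign, so the principal
  logarithms are additive here for every \<open>x\<close>, without \<open>norm (x / (x + 1)) < 1\<close>.\<close>
lemma powr_mult_powr_quotient:
  fixes x m b :: complex
  assumes "x \<noteq> 0" "x \<noteq> -1"
  shows "x powr m * (x / (x + 1)) powr (- m) * (x + 1) powr b = (x + 1) powr (m + b)"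
proof -
  have x1: "x + 1 \<noteq> 0" using assms(2) by (simp add: add_eq_0_iff2)
  have "Ln (x / (x + 1)) = Ln x - Ln (x + 1)"
  proof (rule Ln_unique)
    show "exp (Ln x - Ln (x + 1)) = x / (x + 1)"
      using assms x1 by (simp add: exp_diff)
    have "- pi < Im (Ln x) - Im (Ln (x + 1)) \<and> Im (Ln x) - Im (Ln (x + 1)) \<le> pi"
    proof (cases "Im x" "0::real" rule: linorder_cases)
      case less
      then have "Im (Ln x) < 0" "Im (Ln (x + 1)) < 0"
        using Im_Ln_pos_le[of x] Im_Ln_pos_le[of "x + 1"] assms x1 Im_Ln_le_pi[of x] Im_Ln_le_pi[of "x + 1"]
        by auto
      then show ?thesis
        using mpi_less_Im_Ln[OF assms(1)] mpi_less_Im_Ln[OF x1] by auto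
    next
      case greater
      then show ?thesis
        using Im_Ln_pos_lt_imp[of x] Im_Ln_pos_lt_imp[of "x + 1"] by auto
    next
      case equal
      have "Re x \<noteq> 0" "Re x \<noteq> -1"
        using equal assms by (auto simp: complex_eq_iff)
      \<comment> \<open>For real \<open>x\<close> the two imaginary parts are both pi, then pi and
        0, then both 0. The middle case attains the bound pi, which the principal branch
        includes.\<close>
      then consider "Re x < -1" | "-1 < Re x" "Re x < 0" | "0 < Re x" by linarith
      then show ?thesis
        using equal Im_Ln_eq_pi[OF assms(1)] Im_Ln_eq_pi[OF x1]
          Im_Ln_eq_0[OF assms(1)] Im_Ln_eq_0[OF x1]
        by cases auto
    qed
    then show "- pi < Im (Ln x - Ln (x + 1))" "Im (Ln x - Ln (x + 1)) \<le> pi" by simp_all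
  qed
  then have "m * Ln x + - m * Ln (x / (x + 1)) + b * Ln (x + 1) = (m + b) * Ln (x + 1)"
    by (simp only:) (simp add: algebra_simps)
  then show ?thesis
    using assms x1 by (simp add: powr_def flip: exp_add)
qed

text \<open>The excluded value \<open>x * z + 1 = 0\<close> corresponds to
  \<open>(1 - z) * w = 1\<close> for \<open>w = x / (x + 1)\<close>, the singularity of the
  logarithm. The value is asserted wherever the series converges, boundary points included.\<close>

theorem proposition3p24:
  fixes \<alpha> m x z :: complex
  assumes "x \<noteq> -1"
    and "z \<noteq> 0"
    and "x * z + 1 \<noteq> 0"
    and "m + \<alpha> + 2 \<notin> \<int>\<^sub>\<le>\<^sub>0"
  shows "let t = (\<lambda>n::nat. (x / (x + 1)) ^ n * cbinom (m + of_nat n + \<alpha>) (int n - 1)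
                        * hyp3F2 1 1 (1 - of_nat n) 2 (m + \<alpha> + 2) z)
         in (norm (x / (x + 1)) < 1 \<and> norm ((1 - z) * (x / (x + 1))) < 1 \<longrightarrow> summable t) \<and>
            (summable t \<longrightarrow>
               (\<Sum>n. t n) = 1 / z * x powr m * (x / (x + 1)) powr (- m)
                            * (x + 1) powr (\<alpha> + 1) * Ln (x * z + 1))"
proof -
  define w where "w = x / (x + 1)"
  define s where "s = m + \<alpha>"
  define t where "t = (\<lambda>n::nat. w ^ n * cbinom (m + of_nat n + \<alpha>) (int n - 1)
                        * hyp3F2 1 1 (1 - of_nat n) 2 (m + \<alpha> + 2) z)"
  have s: "s + 2 \<notin> \<int>\<^sub>\<le>\<^sub>0" using assms(4) by (simp add: s_def)
  have x1: "x + 1 \<noteq> 0" using assms(1) by (simp add: add_eq_0_iff2)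
  have t: "t = (\<lambda>n. hyp_coeff s z n * w ^ n)"
    using cbinom_hyp3F2_eq[OF s, of _ z] by (simp add: t_def s_def add_ac mult_ac fun_eq_iff)
  have w: "1 - w = 1 / (x + 1)" "1 - (1 - z) * w = (x * z + 1) / (x + 1)"
    using x1 by (simp_all add: w_def field_simps)
  have w_ne: "w \<noteq> 1" "(1 - z) * w \<noteq> 1"
    using w x1 assms(3) by auto
  have "suminf t = 1 / z * x powr m * w powr (- m) * (x + 1) powr (\<alpha> + 1) * Ln (x * z + 1)"
    if sum: "summable t"
  proof (cases "x = 0")
    \<comment> \<open>Here \<open>w = 0\<close>, so only the term \<open>n = 0\<close> could
      survive, and its coefficient is an empty sum; on the right \<open>Ln 1 = 0\<close>.\<close>
    case True
    then have "t = (\<lambda>_. 0)"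
      by (auto simp: fun_eq_iff t w_def hyp_coeff_def power_0_left)
    then show ?thesis using True by simp
  next
    case False
    have norms: "norm w \<le> 1" "norm ((1 - z) * w) \<le> 1"
      using summable_hyp_coeff_imp_norm_le[OF assms(2) s] sum by (auto simp: t)
    have pos: "Re (1 - w) > 0" "Re (1 - (1 - z) * w) > 0"
      using Re_one_minus_pos norms w_ne by blast+
    have Ln_x1: "Ln (1 - w) = - Ln (x + 1)"
    proof -
      have "1 - w \<notin> \<real>\<^sub>\<le>\<^sub>0" using pos by (auto simp: complex_nonpos_Reals_iff)
      moreover have "x + 1 = inverse (1 - w)" by (simp add: w)
      ultimately show ?thesis by (simp add: Ln_inverse)
    qed
    \<comment> \<open>Both logarithms on the right have arguments in the right half-plane, so their
      imaginary parts are below pi/2 in absolute value and the difference needs no multiple of 2 pi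
      i.\<close>
    have "Ln (x * z + 1) = Ln (1 - (1 - z) * w) - Ln (1 - w)"
    proof (rule Ln_unique)
      show "exp (Ln (1 - (1 - z) * w) - Ln (1 - w)) = x * z + 1"
        using w x1 assms(3) by (simp add: exp_diff)
      show "- pi < Im (Ln (1 - (1 - z) * w) - Ln (1 - w))" "Im (Ln (1 - (1 - z) * w) - Ln (1 - w)) \<le> pi"
        using Re_Ln_pos_lt_imp[OF pos(1)] Re_Ln_pos_lt_imp[OF pos(2)] unfolding minus_complex.sel by linarith+
    qed
    moreover have "(1 - w) powr (- (s + 1)) = (x + 1) powr (s + 1)"
      using Ln_x1 w_ne x1 by (simp add: powr_def algebra_simps)
    moreover have "(x + 1) powr (s + 1) = x powr m * w powr (- m) * (x + 1) powr (\<alpha> + 1)"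
      using powr_mult_powr_quotient[OF False assms(1), of m "\<alpha> + 1"] by (simp add: w_def s_def add_ac)
    ultimately show ?thesis
      using suminf_hyp_coeff[OF assms(2) s sum[unfolded t] w_ne] by (simp add: t)
  qed
  moreover have "summable t" if "norm w < 1" "norm ((1 - z) * w) < 1"
    using hyp_coeff_sums[OF assms(2) that] by (auto simp: t sums_iff)
  ultimately show ?thesis
    unfolding Let_def t_def w_def by blast
qed

end
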